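(* Let $G=(V,E)$ be a finite connected loopless multigraph, let $I\subseteq E$, and let $K_1,\ldots,K_r$ be the connected components of the graph $G\setminus I$ obtained by deleting the edges in $I$ (keeping all vertices; components may be single vertices). Let $x_v>0$ for $v\in V$, $y_e>0$ for $e\in E\setminus I$, and $\alpha'>0$. Then $$\operatorname*{Res}_{y_e=0\,(e\in I)}\mathcal I_G^{\mathrm{corr}}(\alpha')=\frac1{2^{|I|}}\prod_{i=1}^r\mathcal I_{K_i}^{\mathrm{corr}}(\alpha'),$$ where each $K_i$ carries the site energies and remaining edge energies of $G$.
   Context: Loopless means no self-loops; cycles and parallel edges are allowed. The residue at the simultaneous simple poles $y_e=0$, $e\in I$, is the value of $\big(\prod_{e\in I}y_e\big)\,\mathcal I_G^{\mathrm{corr}}(\alpha')$ at $y_e=0$ for all $e\in I$. For a finite connected loopless multigraph $H=(V(H),E(H))$ with site energies $x_v$ and edge energies $y_e$, $$\mathcal I_H^{\mathrm{zono}}(\alpha')=(\alpha')^{|V(H)|}\int_{\mathbb R^{V(H)}}\prod_{v\in V(H)}\mathrm d\tau_v\prod_{v\in V(H)}(2\cosh\tau_v)^{-\alpha' x_v}\prod_{e=uv\in E(H)}(2\cosh(\tau_u-\tau_v))^{-\alpha' y_e},$$ $$\mathcal I_H^{\square}(\alpha')=\prod_{e\in E(H)}\frac{\alpha'}{2}B(2\alpha' y_e,2\alpha' y_e),\qquad \mathcal I_H^{\mathrm{corr}}(\alpha')=\mathcal I_H^{\square}(\alpha')\,\mathcal I_H^{\mathrm{zono}}(\alpha'),$$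 with $B$ the Euler beta function and an empty product equal to $1$. *)

theory Defs
  imports "HOL-Analysis.Analysis" "Graph_Theory.Digraph_Component"
begin

text \<open>
  An undirected multigraph is represented by a multidigraph in which each edge carries an
  arbitrary orientation from its tail to its head. Nothing below depends on this choice:
  the hyperbolic cosine is even, and the predicate connected of Graph_Theory refers to the
  underlying undirected graph.

  Energies are complex-valued so that residues in the edge energies make sense. The bases
  of the powers below are positive reals, so powr is the usual exponential.
\<close>

definition zono_integral ::
    "('v, 'e) pre_digraph \<Rightarrow> ('v \<Rightarrow> complex) \<Rightarrow> ('e \<Rightarrow> complex) \<Rightarrow> real \<Rightarrow> complex" where
  "zono_integral H x y \<alpha> =
     of_real \<alpha> ^ card (verts H) *
     (LINT \<tau> | PiM (verts H) (\<lambda>_. lborel :: real measure).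
        (\<Prod>v\<in>verts H. complex_of_real (2 * cosh (\<tau> v)) powr (- (of_real \<alpha> * x v))) *
        (\<Prod>e\<in>arcs H. complex_of_real (2 * cosh (\<tau> (tail H e) - \<tau> (head H e)))
                        powr (- (of_real \<alpha> * y e))))"

definition square_integral ::
    "('v, 'e) pre_digraph \<Rightarrow> ('e \<Rightarrow> complex) \<Rightarrow> real \<Rightarrow> complex" where
  "square_integral H y \<alpha> =
     (\<Prod>e\<in>arcs H. of_real \<alpha> / 2 * Beta (2 * of_real \<alpha> * y e) (2 * of_real \<alpha> * y e))"

definition corr_integral ::
    "('v, 'e) pre_digraph \<Rightarrow> ('v \<Rightarrow> complex) \<Rightarrow> ('e \<Rightarrow> complex) \<Rightarrow> real \<Rightarrow> complex" where
  "corr_integral H x y \<alpha> = square_integral H y \<alpha> * zono_integral H x y \<alpha>"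

definition delete_edges :: "('v, 'e) pre_digraph \<Rightarrow> 'e set \<Rightarrow> ('v, 'e) pre_digraph" where
  "delete_edges G I = G\<lparr>arcs := arcs G - I\<rparr>"

definition conn_components :: "('v, 'e) pre_digraph \<Rightarrow> ('v, 'e) pre_digraph set" where
  "conn_components G = {K. pre_digraph.max_subgraph G Digraph_Component.connected K}"

text \<open>
  The residue of F at the simultaneous simple poles z e = 0 for e in I, the other variables
  being held at y, is the value at z = 0 of the product of F with all the z e. As F itself
  is singular there, this is the value of the continuous extension, i.e. the limit as all
  the z e tend to 0 jointly through arbitrary nonzero complex numbers.
\<close>

definition has_residue_at_zero ::
    "(('e \<Rightarrow> complex) \<Rightarrow> complex) \<Rightarrow> 'e set \<Rightarrow> ('e \<Rightarrow> complex) \<Rightarrow> complex \<Rightarrow> bool" where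
  "has_residue_at_zero F I y c \<longleftrightarrow>
     ((\<lambda>z. (\<Prod>e\<in>I. z e) * F z) \<longlongrightarrow> c)
       (inf (nhds (\<lambda>e. if e \<in> I then 0 else y e))
            (principal {z. (\<forall>e\<in>I. z e \<noteq> 0) \<and> (\<forall>e. e \<notin> I \<longrightarrow> z e = y e)}))"

end

theory Submission
  imports Defs
begin

text \<open>
  In the product of the edge energies in I with the correlator, each edge in I contributes
  z (\<alpha>/2) Beta (2 \<alpha> z) (2 \<alpha> z), which tends to 1/2 as z tends to 0, while the zonotopal integral is
  continuous up to z = 0. At z = 0 the factors of the edges in I disappear from the integrand,
  which then splits into a product over the connected components of the remaining graph;
  Fubini's theorem splits the integral accordingly.
\<close>


text \<open>The energies on the edges of I approach 0 through arbitrary complex numbers, so their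
  real parts may be negative and the corresponding edge factors may grow exponentially in \<tau>.
  The site energies pay for this: \<open>ln_2cosh (s - t) \<le> ln_2cosh s + ln_2cosh t\<close>
  bounds the growth along an edge by the sites at its two ends, and small edge energies use up only
  part of the decay that the positive site energies provide. The same decay gives convergence at z =
  0, where the edges in I contribute none. Writing each power as an exponential makes the exponent
  linear in the energies, so that perturbing the edge energies multiplies the integrand by a factor
  \<open>exp w\<close>. The constant 1/2 arises because Beta s s behaves like 2/s near 0: at s = 2
  \<alpha> z this is 1/(\<alpha> z), and the prefactor \<alpha>/2 leaves 1/(2 z).\<close>

section \<open>Growth and decay of the hyperbolic factors; an exponential estimate\<close>

definition ln_2cosh :: "real \<Rightarrow> real" where
  "ln_2cosh t = ln (2 * cosh t)"

lemma abs_le_ln_2cosh: "\<bar>t\<bar> \<le> ln_2cosh t"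
proof -
  have "exp \<bar>t\<bar> \<le> 2 * cosh t"
    by (cases "t \<ge> 0") (auto simp: cosh_def)
  then show ?thesis
    unfolding ln_2cosh_def by (subst ln_ge_iff) auto
qed

lemma ln_2cosh_nonneg: "0 \<le> ln_2cosh t"
  using abs_le_ln_2cosh[of t] by linarith

text \<open>The addition formula and |sinh| < cosh give cosh (s - t) \<le> 2 cosh s cosh t. This is
  what lets the site factors control an edge factor.\<close>

lemma ln_2cosh_diff_le: "ln_2cosh (s - t) \<le> ln_2cosh s + ln_2cosh t"
proof -
  have "\<bar>sinh s\<bar> * \<bar>sinh t\<bar> \<le> cosh s * cosh t"
    using sinh_less_cosh_real[of "\<bar>s\<bar>"] sinh_less_cosh_real[of "\<bar>t\<bar>"]
    by (intro mult_mono) (auto simp: abs_if)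
  then have "cosh (s - t) \<le> 2 * cosh s * cosh t"
    unfolding cosh_diff by (simp add: abs_mult [symmetric])
  then have "ln (2 * cosh (s - t)) \<le> ln ((2 * cosh s) * (2 * cosh t))"
    by (subst ln_le_cancel_iff) auto
  also have "\<dots> = ln_2cosh s + ln_2cosh t"
    unfolding ln_2cosh_def by (rule ln_mult_pos) auto
  finally show ?thesis unfolding ln_2cosh_def .
qed

lemma borel_measurable_ln_2cosh [measurable]: "ln_2cosh \<in> borel_measurable borel"
proof -
  have "continuous_on UNIV ln_2cosh"
    unfolding ln_2cosh_def by (intro continuous_intros) (auto simp: less_imp_neq[OF cosh_real_pos, symmetric])
  then show ?thesis by (rule borel_measurable_continuous_onI)
qed

lemma powr_2cosh:
  "complex_of_real (2 * cosh t) powr (- a) = exp (- (a * complex_of_real (ln_2cosh t)))"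
proof -
  have "complex_of_real (2 * cosh t) \<noteq> 0" "Ln (complex_of_real (2 * cosh t)) = ln_2cosh t"
    unfolding ln_2cosh_def by (metis cosh_real_nonzero mult_eq_0_iff of_real_eq_0_iff zero_neq_numeral)
      (rule Ln_of_real, simp)
  then show ?thesis by (simp add: powr_def del: of_real_mult)
qed

lemma integrable_exp_neg_ln_2cosh:
  assumes "0 < b"
  shows "integrable lborel (\<lambda>t. exp (- (b * ln_2cosh t)))"
proof -
  have "(\<lambda>t. exp (- b * t)) absolutely_integrable_on {0..}"
    by (intro nonnegative_absolutely_integrable_1 integrable_on_exp_minus_to_infinity assms) auto
  then have pos: "set_integrable lborel {0..} (\<lambda>t. exp (- b * t))"
    unfolding set_integrable_def by (subst integrable_completion[symmetric]) auto
  \<comment> \<open>The majorant exp (- b |t|) is assembled from the half-line function and its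
    reflection; the reflection is written as an affine map to fit the substitution rule.\<close>
  then have "integrable lborel (\<lambda>t. indicator {0..} (0 + -1 * t) *\<^sub>R exp (- b * (0 + -1 * t)))"
    unfolding set_integrable_def by (intro lborel_integrable_real_affine) auto
  with pos have "integrable lborel (\<lambda>t. indicator {0..} t *\<^sub>R exp (- b * t) +
      indicator {0..} (0 + -1 * t) *\<^sub>R exp (- b * (0 + -1 * t)))"
    unfolding set_integrable_def by (rule Bochner_Integration.integrable_add)
  then show ?thesis
  proof (rule Bochner_Integration.integrable_bound)
    show "AE t in lborel. norm (exp (- (b * ln_2cosh t))) \<le>
      norm (indicator {0..} t *\<^sub>R exp (- b * t) +
        indicator {0..} (0 + -1 * t) *\<^sub>R exp (- b * (0 + -1 * t)))"
    proof (rule AE_I2)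
      fix t :: real
      have "exp (- (b * ln_2cosh t)) \<le> exp (- (b * \<bar>t\<bar>))"
        using abs_le_ln_2cosh[of t] assms by simp
      also have "\<dots> \<le> indicator {0..} t *\<^sub>R exp (- b * t) +
        indicator {0..} (0 + -1 * t) *\<^sub>R exp (- b * (0 + -1 * t))"
        by (auto simp: indicator_def)
      finally show "norm (exp (- (b * ln_2cosh t))) \<le>
        norm (indicator {0..} t *\<^sub>R exp (- b * t) +
          indicator {0..} (0 + -1 * t) *\<^sub>R exp (- b * (0 + -1 * t)))"
        by simp
    qed
  qed auto
qed

text \<open>Termwise comparison of power series, using n! \<le> (n+1)!. The factor
  \<open>norm w\<close> later supplies the smallness and \<open>exp (norm w)\<close> the growth to
  be absorbed.\<close>

lemma norm_exp_minus_1_le: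
  fixes w :: "'a::{real_normed_algebra_1, banach}"
  shows "norm (exp w - 1) \<le> norm w * exp (norm w)"
proof -
  have sw: "(\<lambda>n. w ^ Suc n /\<^sub>R fact (Suc n)) sums (exp w - 1)"
    using exp_converges[of w] by (subst sums_Suc_iff) simp
  have sn: "(\<lambda>n. norm w * (norm w ^ n /\<^sub>R fact n)) sums (norm w * exp (norm w))"
    by (intro sums_mult exp_converges)
  have le: "norm (w ^ Suc n /\<^sub>R fact (Suc n)) \<le> norm w * (norm w ^ n /\<^sub>R fact n)" for n
  proof -
    have "norm (w ^ Suc n /\<^sub>R fact (Suc n)) = norm (w ^ Suc n) / fact (Suc n)"
      by (simp add: divide_inverse_commute)
    also have "\<dots> \<le> norm w ^ Suc n / fact n"
      by (intro frac_le norm_power_ineq fact_mono) auto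
    finally show ?thesis by (simp add: divide_inverse_commute)
  qed
  show ?thesis
    unfolding sums_unique[OF sw] sums_unique[OF sn]
    by (rule norm_suminf_le[OF le sums_summable[OF sn]])
qed

section \<open>Fubini for functions of disjoint sets of coordinates\<close>

text \<open>Invariance under \<open>restrict\<close> expresses that f depends only on the
  coordinates in I and g only on those in J. Along \<open>merge\<close> the product therefore
  becomes a function of the first component times one of the second.\<close>

lemma (in product_sigma_finite) product_integrable_mult:
  fixes f g :: "_ \<Rightarrow> _::{real_normed_field,banach,second_countable_topology}"
  assumes fin: "finite I" "finite J" and disj: "I \<inter> J = {}"
    and f: "integrable (Pi\<^sub>M I M) f" and g: "integrable (Pi\<^sub>M J M) g"
    and rf: "\<And>x. f (restrict x I) = f x" and rg: "\<And>x. g (restrict x J) = g x"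
  shows "integrable (Pi\<^sub>M (I \<union> J) M) (\<lambda>x. f x * g x)"
    and "(\<integral>x. f x * g x \<partial>Pi\<^sub>M (I \<union> J) M) = (\<integral>x. f x \<partial>Pi\<^sub>M I M) * (\<integral>x. g x \<partial>Pi\<^sub>M J M)"
proof -
  interpret I: finite_product_sigma_finite M I by standard fact
  interpret J: finite_product_sigma_finite M J by standard fact
  interpret P: pair_sigma_finite "Pi\<^sub>M I M" "Pi\<^sub>M J M" ..
  have mf: "f (merge I J p) = f (fst p)" and mg: "g (merge I J p) = g (snd p)" for p
    using rf[of "merge I J p"] rf[of "fst p"] rg[of "merge I J p"] rg[of "snd p"] disj
    by (cases p; simp)+
  note [measurable] = borel_measurable_integrable[OF f] borel_measurable_integrable[OF g]
  have "integrable (Pi\<^sub>M I M \<Otimes>\<^sub>M Pi\<^sub>M J M) (\<lambda>p. f (fst p) * g (snd p))"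
    by (rule P.Fubini_integrable) (auto simp: norm_mult f g)
  moreover have meas: "(\<lambda>x. f x * g x) \<in> borel_measurable (Pi\<^sub>M (I \<union> J) M)"
  proof -
    \<comment> \<open>Measurability of f and g is known only on the smaller product spaces;
      composing with \<open>restrict\<close> transfers it to the space over the union.\<close>
    have "(\<lambda>x. f (restrict x I) * g (restrict x J)) \<in> borel_measurable (Pi\<^sub>M (I \<union> J) M)"
      by measurable
    then show ?thesis by (simp only: rf rg)
  qed
  ultimately show int: "integrable (Pi\<^sub>M (I \<union> J) M) (\<lambda>x. f x * g x)"
    by (subst distr_merge[OF disj fin, symmetric], subst integrable_distr_eq) (auto simp: mf mg)
  show "(\<integral>x. f x * g x \<partial>Pi\<^sub>M (I \<union> J) M) = (\<integral>x. f x \<partial>Pi\<^sub>M I M) * (\<integral>x. g x \<partial>Pi\<^sub>M J M)"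
    by (subst product_integral_fold[OF disj fin int]) (simp add: mf mg)
qed

lemma (in product_sigma_finite) product_integral_disjoint_family:
  fixes f :: "'j \<Rightarrow> _ \<Rightarrow> _::{real_normed_field,banach,second_countable_topology}"
  assumes "finite J" and "\<And>j. j \<in> J \<Longrightarrow> finite (A j)" and "disjoint_family_on A J"
    and "\<And>j. j \<in> J \<Longrightarrow> integrable (Pi\<^sub>M (A j) M) (f j)"
    and "\<And>j x. j \<in> J \<Longrightarrow> f j (restrict x (A j)) = f j x"
  shows "integrable (Pi\<^sub>M (\<Union>j\<in>J. A j) M) (\<lambda>x. \<Prod>j\<in>J. f j x) \<and>
    (\<integral>x. (\<Prod>j\<in>J. f j x) \<partial>Pi\<^sub>M (\<Union>j\<in>J. A j) M) = (\<Prod>j\<in>J. \<integral>x. f j x \<partial>Pi\<^sub>M (A j) M)"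
  using assms
proof (induction J rule: finite_induct)
  case empty
  show ?case
    \<comment> \<open>The product measure over no coordinates has total mass 1, so the constant 1
      integrates to the empty product.\<close>
    using product_integrable_prod[of "{}" "\<lambda>_ _. 1"] product_integral_prod[of "{}" "\<lambda>_ _. 1"]
    by simp
next
  case (insert j J)
  let ?B = "\<Union>j\<in>J. A j"
  have disj: "A j \<inter> ?B = {}"
    using insert.prems(2) insert.hyps by (auto simp: disjoint_family_on_def)
  have fin: "finite (A j)" "finite ?B"
    using insert.prems(1) insert.hyps by auto
  have IH: "integrable (Pi\<^sub>M ?B M) (\<lambda>x. \<Prod>j\<in>J. f j x)"
    "(\<integral>x. (\<Prod>j\<in>J. f j x) \<partial>Pi\<^sub>M ?B M) = (\<Prod>j\<in>J. \<integral>x. f j x \<partial>Pi\<^sub>M (A j) M)"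
    using insert.IH insert.prems by (auto simp: disjoint_family_on_def)
  have rj: "f j (restrict x (A j)) = f j x" for x
    by (rule insert.prems(4)[OF insertI1])
  have rJ: "(\<Prod>j\<in>J. f j (restrict x ?B)) = (\<Prod>j\<in>J. f j x)" for x
  proof (rule prod.cong[OF refl])
    fix k assume k: "k \<in> J"
    have "restrict (restrict x ?B) (A k) = restrict x (A k)"
      using k by (auto simp: restrict_def fun_eq_iff)
    then show "f k (restrict x ?B) = f k x"
      using insert.prems(4)[of k] k by (metis insertI2)
  qed
  note two = product_integrable_mult[OF fin disj insert.prems(3)[OF insertI1] IH(1) rj rJ]
  from two show ?case
    using insert.hyps by (simp add: IH(2))
qed

section \<open>The pole of the Beta function at equal arguments\<close>

text \<open>Away from 0, z Gamma(z) is the reciprocal of \<open>rGamma (z + 1)\<close>, which is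
  continuous with value 1 at z = 0.\<close>

lemma tendsto_mult_Gamma_at_0: "((\<lambda>z::complex. z * Gamma z) \<longlongrightarrow> 1) (at 0)"
proof -
  have "((\<lambda>z::complex. inverse (rGamma (z + 1))) \<longlongrightarrow> inverse (rGamma (0 + 1))) (at 0)"
    by (intro tendsto_intros continuous_on_tendsto_compose[OF continuous_on_rGamma[of UNIV]]) auto
  moreover have "\<forall>\<^sub>F z::complex in at 0. inverse (rGamma (z + 1)) = z * Gamma z"
    unfolding eventually_at_filter
  proof (rule always_eventually, intro allI impI)
    fix z :: complex assume "z \<noteq> 0"
    then show "inverse (rGamma (z + 1)) = z * Gamma z"
      by (simp add: Gamma_def rGamma_plus1[symmetric, of z])
  qed
  ultimately show ?thesis by (simp add: filterlim_cong)
qed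

text \<open>The 2 comes from the doubled argument in the denominator: z Beta z z = 2 (z Gamma z)^2 /
  (2 z Gamma (2 z)), and both z Gamma z and 2 z Gamma (2 z) tend to 1.\<close>

lemma tendsto_mult_Beta_at_0: "((\<lambda>z::complex. z * Beta z z) \<longlongrightarrow> 2) (at 0)"
proof -
  have two: "filterlim (\<lambda>z::complex. 2 * z) (at 0) (at 0)"
    by (auto simp: filterlim_at eventually_at_filter intro!: tendsto_eq_intros)
  have "((\<lambda>z::complex. 2 * (z * Gamma z)\<^sup>2 / (2 * z * Gamma (2 * z))) \<longlongrightarrow> 2 * 1\<^sup>2 / 1) (at 0)"
    by (intro tendsto_intros tendsto_mult_Gamma_at_0
        filterlim_compose[OF tendsto_mult_Gamma_at_0 two, simplified]) simp
  moreover have "2 * (z * Gamma z)\<^sup>2 / (2 * z * Gamma (2 * z)) = z * Beta z z" for z :: complex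
    unfolding Beta_def power2_eq_square mult_2 [symmetric] by simp
  ultimately show ?thesis by simp
qed

section \<open>Integrability of the zonotopal integrand and continuity in the edge energies\<close>

definition zono_integrand ::
    "('v, 'e) pre_digraph \<Rightarrow> ('v \<Rightarrow> complex) \<Rightarrow> ('e \<Rightarrow> complex) \<Rightarrow> real \<Rightarrow> ('v \<Rightarrow> real) \<Rightarrow> complex" where
  "zono_integrand H x y \<alpha> \<tau> =
     exp (- (of_real \<alpha> * ((\<Sum>v\<in>verts H. x v * of_real (ln_2cosh (\<tau> v))) +
       (\<Sum>e\<in>arcs H. y e * of_real (ln_2cosh (\<tau> (tail H e) - \<tau> (head H e)))))))"

lemma zono_integral_eq:
  assumes "fin_digraph H"
  shows "zono_integral H x y \<alpha> =
    of_real \<alpha> ^ card (verts H) *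
      (LINT \<tau> | PiM (verts H) (\<lambda>_. lborel). zono_integrand H x y \<alpha> \<tau>)"
proof -
  interpret fin_digraph H by fact
  show ?thesis
    unfolding zono_integral_def zono_integrand_def powr_2cosh
    by (simp add: exp_sum[symmetric] exp_add[symmetric] sum_negf sum_distrib_left distrib_left mult.assoc)
qed

lemma borel_measurable_zono_integrand:
  assumes "wf_digraph H"
  shows "zono_integrand H x y \<alpha> \<in> borel_measurable (PiM (verts H) (\<lambda>_. lborel))"
proof -
  interpret wf_digraph H by fact
  have comp [measurable]: "(\<lambda>\<tau>. \<tau> v) \<in> borel_measurable (PiM (verts H) (\<lambda>_. lborel :: real measure))"
    if "v \<in> verts H" for v
    using measurable_component_singleton[OF that, of "\<lambda>_. lborel :: real measure"] by simp
  have [measurable]: "(\<lambda>\<tau>. \<tau> (tail H e) - \<tau> (head H e)) \<in>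
    borel_measurable (PiM (verts H) (\<lambda>_. lborel :: real measure))" if "e \<in> arcs H" for e
    using that by (intro borel_measurable_diff comp) auto
  show ?thesis unfolding zono_integrand_def by measurable
qed

lemma zono_integrand_restrict:
  assumes "wf_digraph H"
  shows "zono_integrand H x y \<alpha> (restrict \<tau> (verts H)) = zono_integrand H x y \<alpha> \<tau>"
proof -
  interpret wf_digraph H by fact
  show ?thesis unfolding zono_integrand_def by simp
qed

text \<open>Edge factors with nonnegative real energy have modulus at most 1, so only the site decay
  remains, at a common rate m. The bound is a product over the sites and hence easy to
  integrate.\<close>

lemma norm_zono_integrand_le:
  assumes "\<And>v. v \<in> verts H \<Longrightarrow> m \<le> Re (x v)" and "\<And>e. e \<in> arcs H \<Longrightarrow> 0 \<le> Re (y e)" and "0 \<le> \<alpha>"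
  shows "norm (zono_integrand H x y \<alpha> \<tau>) \<le> exp (- (\<alpha> * m * (\<Sum>v\<in>verts H. ln_2cosh (\<tau> v))))"
proof -
  have "m * (\<Sum>v\<in>verts H. ln_2cosh (\<tau> v)) \<le> (\<Sum>v\<in>verts H. Re (x v) * ln_2cosh (\<tau> v))"
    unfolding sum_distrib_left by (intro sum_mono mult_right_mono assms ln_2cosh_nonneg)
  moreover have "0 \<le> (\<Sum>e\<in>arcs H. Re (y e) * ln_2cosh (\<tau> (tail H e) - \<tau> (head H e)))"
    by (intro sum_nonneg mult_nonneg_nonneg assms ln_2cosh_nonneg)
  ultimately have "\<alpha> * (m * (\<Sum>v\<in>verts H. ln_2cosh (\<tau> v))) \<le>
      \<alpha> * ((\<Sum>v\<in>verts H. Re (x v) * ln_2cosh (\<tau> v)) +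
        (\<Sum>e\<in>arcs H. Re (y e) * ln_2cosh (\<tau> (tail H e) - \<tau> (head H e))))"
    using assms(3) by (intro mult_left_mono) auto
  then show ?thesis
    unfolding zono_integrand_def norm_exp_eq_Re by (simp add: mult.assoc)
qed

lemma integrable_exp_neg_sum_ln_2cosh:
  assumes "finite V" and "0 < b"
  shows "integrable (PiM V (\<lambda>_. lborel)) (\<lambda>\<tau>. exp (- (b * (\<Sum>v\<in>V. ln_2cosh (\<tau> v)))))"
proof -
  interpret product_sigma_finite "\<lambda>_ :: 'a. lborel :: real measure" by standard
  have "integrable (PiM V (\<lambda>_. lborel)) (\<lambda>\<tau>. \<Prod>v\<in>V. exp (- (b * ln_2cosh (\<tau> v))))"
    using assms by (intro product_integrable_prod integrable_exp_neg_ln_2cosh)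
  then show ?thesis
    using assms by (simp add: exp_sum[symmetric] sum_negf sum_distrib_left)
qed

lemma finite_positive_lower_bound:
  fixes f :: "'a \<Rightarrow> real"
  assumes "finite A" and "\<And>a. a \<in> A \<Longrightarrow> 0 < f a"
  obtains m where "0 < m" and "\<And>a. a \<in> A \<Longrightarrow> m \<le> f a"
proof
  \<comment> \<open>Inserting 1 keeps the minimum meaningful when A is empty.\<close>
  show "0 < Min (insert 1 (f ` A))" using assms by (subst Min_gr_iff) auto
  show "Min (insert 1 (f ` A)) \<le> f a" if "a \<in> A" for a using that assms(1) by (intro Min_le) auto
qed

lemma integrable_zono_integrand:
  assumes "fin_digraph H" and "\<And>v. v \<in> verts H \<Longrightarrow> 0 < Re (x v)"
    and "\<And>e. e \<in> arcs H \<Longrightarrow> 0 \<le> Re (y e)" and "0 < \<alpha>"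
  shows "integrable (PiM (verts H) (\<lambda>_. lborel)) (zono_integrand H x y \<alpha>)"
proof -
  interpret fin_digraph H by fact
  obtain m where m: "0 < m" "\<And>v. v \<in> verts H \<Longrightarrow> m \<le> Re (x v)"
    using finite_positive_lower_bound[OF finite_verts, of "\<lambda>v. Re (x v)"] assms(2) by auto
  have "integrable (PiM (verts H) (\<lambda>_. lborel))
      (\<lambda>\<tau>. exp (- (\<alpha> * m * (\<Sum>v\<in>verts H. ln_2cosh (\<tau> v)))))"
    using m assms by (intro integrable_exp_neg_sum_ln_2cosh) auto
  then show ?thesis
  proof (rule Bochner_Integration.integrable_bound)
    show "AE \<tau> in PiM (verts H) (\<lambda>_. lborel). norm (zono_integrand H x y \<alpha> \<tau>) \<le>
        norm (exp (- (\<alpha> * m * (\<Sum>v\<in>verts H. ln_2cosh (\<tau> v)))))"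
      using norm_zono_integrand_le[of H m x y \<alpha>] m assms by (intro AE_I2) simp
  qed (intro borel_measurable_zono_integrand wf_digraph_axioms)
qed

text \<open>
  Since F need not be countably generated, the dominated convergence theorem does not apply.
  Instead, the difference of the integrands is bounded by r/\<delta> times a fixed integrable function,
  where r is the sum of the distances of the edge energies.
\<close>

lemma tendsto_zono_integral:
  fixes z :: "'a \<Rightarrow> 'e \<Rightarrow> complex"
  assumes "fin_digraph H" and "\<And>v. v \<in> verts H \<Longrightarrow> 0 < Re (x v)"
    and "\<And>e. e \<in> arcs H \<Longrightarrow> 0 \<le> Re (y e)" and "0 < \<alpha>"
    and lim: "\<And>e. e \<in> arcs H \<Longrightarrow> ((\<lambda>k. z k e) \<longlongrightarrow> y e) F"
  shows "((\<lambda>k. zono_integral H x (z k) \<alpha>) \<longlongrightarrow> zono_integral H x y \<alpha>) F"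
proof -
  interpret fin_digraph H by fact
  let ?M = "PiM (verts H) (\<lambda>_. lborel :: real measure)"
  obtain m where m: "0 < m" "\<And>v. v \<in> verts H \<Longrightarrow> m \<le> Re (x v)"
    using finite_positive_lower_bound[OF finite_verts, of "\<lambda>v. Re (x v)"] assms(2) by auto
  \<comment> \<open>With t = 2 \<alpha> \<delta> S, the estimates below cost a factor exp (2 t) =
    exp (\<alpha> m S / 2). This leaves exactly half of the site decay exp (- \<alpha> m S).\<close>
  define \<delta> where "\<delta> = m / 8"
  define r where "r k = (\<Sum>e\<in>arcs H. norm (z k e - y e))" for k
  define S where "S \<tau> = (\<Sum>v\<in>verts H. ln_2cosh (\<tau> v))" for \<tau> :: "'b \<Rightarrow> real"
  define C where "C = (LINT \<tau>|?M. exp (- (\<alpha> * m / 2 * S \<tau>)))"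
  have \<delta>: "0 < \<delta>" using m by (simp add: \<delta>_def)
  have r_nonneg: "0 \<le> r k" for k unfolding r_def by (intro sum_nonneg) auto
  have S_nonneg: "0 \<le> S \<tau>" for \<tau> unfolding S_def by (intro sum_nonneg ln_2cosh_nonneg)
  have r_lim: "(r \<longlongrightarrow> 0) F"
    unfolding r_def by (intro tendsto_null_sum tendsto_norm_zero) (auto simp: LIM_zero lim)
  have edge_le: "ln_2cosh (\<tau> (tail H e) - \<tau> (head H e)) \<le> 2 * S \<tau>" if "e \<in> arcs H" for e \<tau>
  proof -
    have le: "ln_2cosh (\<tau> v) \<le> S \<tau>" if "v \<in> verts H" for v
      unfolding S_def using that by (intro member_le_sum ln_2cosh_nonneg) auto
    have "ln_2cosh (\<tau> (tail H e) - \<tau> (head H e)) \<le> ln_2cosh (\<tau> (tail H e)) + ln_2cosh (\<tau> (head H e))"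
      by (rule ln_2cosh_diff_le)
    also have "\<dots> \<le> S \<tau> + S \<tau>" using that by (intro add_mono le) auto
    finally show ?thesis by simp
  qed
  have int_C: "integrable ?M (\<lambda>\<tau>. exp (- (\<alpha> * m / 2 * S \<tau>)))"
    unfolding S_def using m assms by (intro integrable_exp_neg_sum_ln_2cosh) auto
  have int_y: "integrable ?M (zono_integrand H x y \<alpha>)"
    using assms by (intro integrable_zono_integrand) auto
  have ptwise: "norm (zono_integrand H x (z k) \<alpha> \<tau> - zono_integrand H x y \<alpha> \<tau>) \<le>
      r k / \<delta> * exp (- (\<alpha> * m / 2 * S \<tau>))" if "r k \<le> \<delta>" for k \<tau>
  proof -
    define w where "w = - (of_real \<alpha> *
      (\<Sum>e\<in>arcs H. (z k e - y e) * of_real (ln_2cosh (\<tau> (tail H e) - \<tau> (head H e)))))"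
    have "zono_integrand H x (z k) \<alpha> \<tau> = zono_integrand H x y \<alpha> \<tau> * exp w"
      unfolding zono_integrand_def w_def exp_add[symmetric]
      by (simp add: algebra_simps sum_subtractf)
    then have diff: "zono_integrand H x (z k) \<alpha> \<tau> - zono_integrand H x y \<alpha> \<tau> =
        zono_integrand H x y \<alpha> \<tau> * (exp w - 1)"
      by (simp add: algebra_simps)
    have "norm (\<Sum>e\<in>arcs H. (z k e - y e) * complex_of_real (ln_2cosh (\<tau> (tail H e) - \<tau> (head H e))))
        \<le> (\<Sum>e\<in>arcs H. norm (z k e - y e) * (2 * S \<tau>))"
      by (intro sum_norm_le)
        (auto simp: norm_mult edge_le ln_2cosh_nonneg intro!: mult_left_mono)
    also have "\<dots> = r k * (2 * S \<tau>)" by (simp add: r_def sum_distrib_right)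
    finally have w_le: "norm w \<le> \<alpha> * (r k * (2 * S \<tau>))"
      unfolding w_def using assms(4) by (simp add: norm_mult)
    \<comment> \<open>Bounds \<open>norm w\<close> for every k with
      \<open>r k \<le> \<delta>\<close>, while the finer bound \<open>r k / \<delta> * t\<close>
      retains the factor that tends to 0.\<close>
    define t where "t = 2 * \<alpha> * \<delta> * S \<tau>"
    have w_le1: "norm w \<le> r k / \<delta> * t"
      using w_le \<delta> by (simp add: t_def mult_ac)
    have t_nonneg: "0 \<le> t" using S_nonneg \<delta> assms(4) by (simp add: t_def)
    have "r k / \<delta> * t \<le> 1 * t" using that \<delta> by (intro mult_right_mono t_nonneg) auto
    then have w_le2: "norm w \<le> t" using w_le1 by simp
    have "norm (exp w - 1) \<le> norm w * exp (norm w)" by (rule norm_exp_minus_1_le)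
    also have "\<dots> \<le> (r k / \<delta> * t) * exp t"
      using w_le1 w_le2 t_nonneg r_nonneg \<delta> by (intro mult_mono) auto
    also have "\<dots> = r k / \<delta> * (t * exp t)" by simp
    \<comment> \<open>The linear factor t is unbounded in \<tau>; t \<le> exp t trades it for a
      second exponential, which the site decay can absorb.\<close>
    also have "\<dots> \<le> r k / \<delta> * (exp t * exp t)"
      using exp_ge_add_one_self[of t] r_nonneg \<delta>
      by (intro mult_left_mono mult_right_mono) (auto simp del: exp_ge_add_one_self)
    finally have e: "norm (exp w - 1) \<le> r k / \<delta> * exp (2 * t)"
      by (simp add: exp_double power2_eq_square)
    have "norm (zono_integrand H x y \<alpha> \<tau> * (exp w - 1)) \<le>
        exp (- (\<alpha> * m * S \<tau>)) * (r k / \<delta> * exp (2 * t))"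
      unfolding norm_mult S_def
      using m assms by (intro mult_mono e norm_zono_integrand_le) auto
    also have "\<dots> = r k / \<delta> * exp (- (\<alpha> * m * S \<tau>) + 2 * t)" by (simp only: exp_add mult_ac)
    also have "- (\<alpha> * m * S \<tau>) + 2 * t = - (\<alpha> * m / 2 * S \<tau>)" by (simp add: t_def \<delta>_def)
    finally show ?thesis unfolding diff .
  qed
  have bound: "norm (zono_integral H x (z k) \<alpha> - zono_integral H x y \<alpha>) \<le> \<alpha> ^ card (verts H) * (r k / \<delta> * C)"
    if "r k \<le> \<delta>" for k
  proof -
    have int_d: "integrable ?M (\<lambda>\<tau>. zono_integrand H x (z k) \<alpha> \<tau> - zono_integrand H x y \<alpha> \<tau>)"
      using int_C[THEN integrable_mult_right, of "r k / \<delta>"]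
    proof (rule Bochner_Integration.integrable_bound)
      show "AE \<tau> in ?M. norm (zono_integrand H x (z k) \<alpha> \<tau> - zono_integrand H x y \<alpha> \<tau>) \<le>
          norm (r k / \<delta> * exp (- (\<alpha> * m / 2 * S \<tau>)))"
        by (intro AE_I2 order_trans[OF ptwise[OF that]]) (simp only: real_norm_def abs_ge_self)
    qed (intro borel_measurable_diff borel_measurable_zono_integrand wf_digraph_axioms)
    \<comment> \<open>The real parts of \<open>z k\<close> may be negative, so integrability at
      \<open>z k\<close> is recovered from the difference and the integrand at y.\<close>
    have "integrable ?M (\<lambda>\<tau>. (zono_integrand H x (z k) \<alpha> \<tau> - zono_integrand H x y \<alpha> \<tau>) + zono_integrand H x y \<alpha> \<tau>)"
      by (rule Bochner_Integration.integrable_add[OF int_d int_y])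
    then have int_z: "integrable ?M (zono_integrand H x (z k) \<alpha>)" by simp
    have "zono_integral H x (z k) \<alpha> - zono_integral H x y \<alpha> = of_real \<alpha> ^ card (verts H) *
        (LINT \<tau>|?M. zono_integrand H x (z k) \<alpha> \<tau> - zono_integrand H x y \<alpha> \<tau>)"
      unfolding zono_integral_eq[OF assms(1)] Bochner_Integration.integral_diff[OF int_z int_y]
      by (simp add: algebra_simps)
    also have "norm \<dots> = \<alpha> ^ card (verts H) *
        norm (LINT \<tau>|?M. zono_integrand H x (z k) \<alpha> \<tau> - zono_integrand H x y \<alpha> \<tau>)"
      using assms(4) by (simp add: norm_mult norm_power)
    also have "norm (LINT \<tau>|?M. zono_integrand H x (z k) \<alpha> \<tau> - zono_integrand H x y \<alpha> \<tau>)
        \<le> (LINT \<tau>|?M. r k / \<delta> * exp (- (\<alpha> * m / 2 * S \<tau>)))"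
    proof (rule order_trans[OF integral_norm_bound integral_mono])
      show "integrable ?M (\<lambda>\<tau>. r k / \<delta> * exp (- (\<alpha> * m / 2 * S \<tau>)))"
        by (intro integrable_mult_right int_C)
    qed (rule integrable_norm[OF int_d], rule ptwise[OF that])
    also have "\<dots> = r k / \<delta> * C" by (simp add: C_def)
    finally show ?thesis using assms(4) by simp
  qed
  have "((\<lambda>k. zono_integral H x (z k) \<alpha> - zono_integral H x y \<alpha>) \<longlongrightarrow> 0) F"
  proof (rule Lim_null_comparison)
    show "\<forall>\<^sub>F k in F. norm (zono_integral H x (z k) \<alpha> - zono_integral H x y \<alpha>) \<le>
        \<alpha> ^ card (verts H) * (r k / \<delta> * C)"
      using order_tendstoD(2)[OF r_lim \<delta>] by eventually_elim (rule bound, simp)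
    have "((\<lambda>k. \<alpha> ^ card (verts H) * (r k / \<delta> * C)) \<longlongrightarrow> \<alpha> ^ card (verts H) * (0 / \<delta> * C)) F"
      using \<delta> by (intro tendsto_intros r_lim) auto
    then show "((\<lambda>k. \<alpha> ^ card (verts H) * (r k / \<delta> * C)) \<longlongrightarrow> 0) F" by simp
  qed
  then show ?thesis by (rule LIM_zero_cancel)
qed

section \<open>Connected components as a partition of the vertices and edges\<close>

text \<open>Connectedness means strong connectedness of the symmetrization, and symmetrizing
  commutes with the union of compatible graphs. This reduces the claim to strongly connected graphs
  that share a vertex.\<close>

lemma connected_union:
  assumes "wf_digraph G" and "wf_digraph H" and "compatible G H"
    and "Digraph_Component.connected G" and "Digraph_Component.connected H"
    and "verts G \<inter> verts H \<noteq> {}"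
  shows "Digraph_Component.connected (Digraph_Component.union G H)"
proof -
  interpret G: pair_wf_digraph "mk_symmetric G"
    using assms(1) by (rule wf_digraph.wellformed_mk_symmetric)
  interpret H: pair_wf_digraph "mk_symmetric H"
    using assms(2) by (rule wf_digraph.wellformed_mk_symmetric)
  have "strongly_connected (Digraph_Component.union (mk_symmetric G) (mk_symmetric H))"
    using assms unfolding connected_def
    by (intro strongly_connected_non_disj) (auto intro: G.wf_digraph_axioms H.wf_digraph_axioms)
  moreover have "Digraph_Component.union (mk_symmetric G) (mk_symmetric H) =
      with_proj (mk_symmetric (Digraph_Component.union G H))"
    using compatible_tail[OF assms(3)] compatible_head[OF assms(3)]
    by (auto simp: union_def mk_symmetric_def)
  ultimately show ?thesis unfolding connected_def by simp
qed

text \<open>One-vertex and one-arc graphs are the seeds that are enlarged to components, which shows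
  that the components cover all vertices and arcs.\<close>

lemma connected_single_vertex:
  "Digraph_Component.connected \<lparr>verts = {v}, arcs = {}, tail = t, head = h\<rparr>"
  by (simp add: connected_conv)

lemma connected_single_arc:
  "Digraph_Component.connected \<lparr>verts = {t e, h e}, arcs = {e}, tail = t, head = h\<rparr>"
proof -
  have "(t e, h e) \<in> rtrancl_on {t e, h e} {(t e, h e), (h e, t e)}"
    "(h e, t e) \<in> rtrancl_on {t e, h e} {(t e, h e), (h e, t e)}"
    by (auto intro: rtrancl_on_into_rtrancl_on)
  moreover have "(arcs_ends \<lparr>verts = {t e, h e}, arcs = {e}, tail = t, head = h\<rparr>)\<^sup>s =
      {(t e, h e), (h e, t e)}"
    by (auto simp: arcs_ends_conv symcl_def)
  ultimately show ?thesis by (auto simp: connected_conv)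
qed

lemma conn_componentsD:
  assumes "K \<in> conn_components G"
  shows "subgraph K G" and "Digraph_Component.connected K"
    and "\<And>H. subgraph K H \<Longrightarrow> subgraph H G \<Longrightarrow> Digraph_Component.connected H \<Longrightarrow> H = K"
  using assms by (auto simp: conn_components_def pre_digraph.max_subgraph_def)

lemma subgraph_eqI:
  fixes G H :: "('a, 'b) pre_digraph"
  assumes "subgraph H G" and "verts H = verts G" and "arcs H = arcs G"
  shows "H = G"
  using assms by (auto simp: compatible_def intro!: pre_digraph.equality elim!: subgraphE)

text \<open>Among the connected subgraphs containing H, one with the largest number of vertices plus
  arcs is maximal: a larger connected subgraph would have equal counts, hence the same finite vertex
  and arc sets.\<close>

lemma connected_subgraph_in_conn_component:
  assumes "fin_digraph G" and "subgraph H G" and "Digraph_Component.connected H"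
  obtains K where "K \<in> conn_components G" and "subgraph H K"
proof -
  interpret fin_digraph G by fact
  let ?P = "\<lambda>K. subgraph H K \<and> subgraph K G \<and> Digraph_Component.connected K"
  let ?c = "\<lambda>K. card (verts K) + card (arcs K)"
  have "?P H" using assms by (auto simp: wf_digraph.subgraph_refl elim: subgraphE)
  moreover have "\<forall>K. ?P K \<longrightarrow> ?c K < card (verts G) + card (arcs G) + 1"
    by (auto elim!: subgraphE intro!: add_mono card_mono le_imp_less_Suc)
  ultimately obtain K where K: "?P K" and max: "\<And>K'. ?P K' \<Longrightarrow> ?c K' \<le> ?c K"
    using ex_has_greatest_nat[of ?P H ?c] by blast
  have "K' = K" if K': "subgraph K K'" "subgraph K' G" "Digraph_Component.connected K'" for K'
  proof -
    have sub: "verts K \<subseteq> verts K'" "arcs K \<subseteq> arcs K'" using K'(1) by auto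
    have fin: "finite (verts K')" "finite (arcs K')"
      using K'(2) by (auto elim!: subgraphE intro: finite_subset)
    have "?c K' \<le> ?c K" using K K' by (intro max) (auto intro: subgraph_trans)
    moreover have "card (verts K) \<le> card (verts K')" "card (arcs K) \<le> card (arcs K')"
      using sub fin by (auto intro: card_mono)
    ultimately have "card (verts K) = card (verts K')" "card (arcs K) = card (arcs K')" by auto
    then have "verts K = verts K'" "arcs K = arcs K'"
      using sub fin by (simp_all add: card_subset_eq)
    then show ?thesis using subgraph_eqI[OF K'(1)] by simp
  qed
  then have "K \<in> conn_components G"
    using K by (auto simp: conn_components_def intro!: pre_digraph.max_subgraphI)
  then show thesis using K that by blast
qed

text \<open>If two components share a vertex, their union is a connected subgraph containing both,
  so maximality identifies it with each of them.\<close>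

lemma conn_components_eq:
  assumes "K \<in> conn_components G" and "L \<in> conn_components G" and "verts K \<inter> verts L \<noteq> {}"
  shows "K = L"
proof -
  note K = conn_componentsD[OF assms(1)] and L = conn_componentsD[OF assms(2)]
  have wf: "wf_digraph K" "wf_digraph L" and comp: "compatible K L" "compatible K G" "compatible L G"
    using K(1) L(1) by (auto simp: compatible_def elim!: subgraphE)
  let ?U = "Digraph_Component.union K L"
  have "subgraph ?U G" using K(1) L(1) comp by auto
  moreover have "Digraph_Component.connected ?U"
    using wf comp(1) K(2) L(2) assms(3) by (rule connected_union)
  ultimately have "?U = K" "?U = L"
    using K(3) L(3) subgraphs_of_union[OF wf comp(1)] by auto
  then show ?thesis by simp
qed

lemma disjoint_verts_conn_components: "disjoint_family_on verts (conn_components G)"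
  using conn_components_eq by (fastforce simp: disjoint_family_on_def)

lemma disjoint_arcs_conn_components: "disjoint_family_on arcs (conn_components G)"
proof (unfold disjoint_family_on_def, intro ballI impI)
  fix K L assume KL: "K \<in> conn_components G" "L \<in> conn_components G" "K \<noteq> L"
  \<comment> \<open>A common arc would give a common vertex, namely its tail.\<close>
  then have "tail G e \<in> verts K \<inter> verts L" if "e \<in> arcs K \<inter> arcs L" for e
    using that conn_componentsD(1)[OF KL(1)] conn_componentsD(1)[OF KL(2)]
    by (auto simp: compatible_def dest: wf_digraph.tail_in_verts elim!: subgraphE)
  then show "arcs K \<inter> arcs L = {}" using conn_components_eq[OF KL(1,2)] KL(3) by blast
qed

lemma UN_verts_conn_components:
  assumes "fin_digraph G"
  shows "(\<Union>K\<in>conn_components G. verts K) = verts G"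
proof (intro equalityI subsetI)
  interpret fin_digraph G by fact
  fix v assume v: "v \<in> verts G"
  have "subgraph \<lparr>verts = {v}, arcs = {}, tail = tail G, head = head G\<rparr> G"
    using v by (intro subgraphI) (auto simp: compatible_def intro!: wf_digraph.intro wf_digraph_axioms)
  then obtain K where "K \<in> conn_components G"
    "subgraph \<lparr>verts = {v}, arcs = {}, tail = tail G, head = head G\<rparr> K"
    using connected_subgraph_in_conn_component[OF assms _ connected_single_vertex] by blast
  then show "v \<in> (\<Union>K\<in>conn_components G. verts K)" by (auto elim!: subgraphE)
qed (auto dest!: conn_componentsD(1) elim!: subgraphE)

lemma UN_arcs_conn_components:
  assumes "fin_digraph G"
  shows "(\<Union>K\<in>conn_components G. arcs K) = arcs G"
proof (intro equalityI subsetI)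
  interpret fin_digraph G by fact
  fix e assume e: "e \<in> arcs G"
  let ?H = "\<lparr>verts = {tail G e, head G e}, arcs = {e}, tail = tail G, head = head G\<rparr>"
  have "subgraph ?H G"
    using e by (intro subgraphI) (auto simp: compatible_def intro!: wf_digraph.intro wf_digraph_axioms)
  then obtain K where "K \<in> conn_components G" "subgraph ?H K"
    using connected_subgraph_in_conn_component[OF assms _ connected_single_arc] by blast
  then show "e \<in> (\<Union>K\<in>conn_components G. arcs K)" by (auto elim!: subgraphE)
qed (auto dest!: conn_componentsD(1) elim!: subgraphE)

text \<open>A component is determined by its vertex set, since connected graphs are nonempty and
  distinct components share no vertex. So there are at most as many components as subsets of the
  vertices.\<close>

lemma finite_conn_components:
  assumes "fin_digraph G"
  shows "finite (conn_components G)"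
proof (rule finite_imageD)
  interpret fin_digraph G by fact
  have "verts ` conn_components G \<subseteq> Pow (verts G)"
    by (auto dest!: conn_componentsD(1) elim!: subgraphE)
  then show "finite (verts ` conn_components G)" by (rule finite_subset) simp
  show "inj_on verts (conn_components G)"
  proof (rule inj_onI)
    fix K L assume KL: "K \<in> conn_components G" "L \<in> conn_components G" "verts K = verts L"
    have "verts K \<noteq> {}" using conn_componentsD(2)[OF KL(1)] by (simp add: connected_conv)
    with KL show "K = L" using conn_components_eq by blast
  qed
qed

section \<open>Factorization of the correlator over components\<close>

lemma corr_integral_conn_components:
  fixes H :: "('v, 'e) pre_digraph"
  assumes "fin_digraph H" and "\<And>v. v \<in> verts H \<Longrightarrow> 0 < Re (x v)"
    and "\<And>e. e \<in> arcs H \<Longrightarrow> 0 \<le> Re (y e)" and "0 < \<alpha>"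
  shows "corr_integral H x y \<alpha> = (\<Prod>K\<in>conn_components H. corr_integral K x y \<alpha>)"
proof -
  interpret fin_digraph H by fact
  interpret product_sigma_finite "\<lambda>_ :: 'v. lborel :: real measure" by standard
  let ?J = "conn_components H"
  have sub: "verts K \<subseteq> verts H" "arcs K \<subseteq> arcs H" "tail K = tail H" "head K = head H"
    "fin_digraph K" if "K \<in> ?J" for K
    using conn_componentsD(1)[OF that] fin_digraph_subgraph
    by (auto simp: compatible_def elim!: subgraphE)
  have finV: "finite (verts K)" and finA: "finite (arcs K)" if "K \<in> ?J" for K
    by (rule finite_subset[OF sub(1)[OF that] finite_verts], rule finite_subset[OF sub(2)[OF that] finite_arcs])
  note fin = finite_conn_components[OF assms(1)]
  note UV = UN_verts_conn_components[OF assms(1)] and UA = UN_arcs_conn_components[OF assms(1)]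
  have dV: "\<forall>K\<in>?J. \<forall>L\<in>?J. K \<noteq> L \<longrightarrow> verts K \<inter> verts L = {}"
    using disjoint_verts_conn_components by (auto simp: disjoint_family_on_def)
  have dA: "\<forall>K\<in>?J. \<forall>L\<in>?J. K \<noteq> L \<longrightarrow> arcs K \<inter> arcs L = {}"
    using disjoint_arcs_conn_components by (auto simp: disjoint_family_on_def)
  have sum_verts: "(\<Sum>v\<in>verts H. f v) = (\<Sum>K\<in>?J. \<Sum>v\<in>verts K. f v)" for f :: "'v \<Rightarrow> complex"
    unfolding UV[symmetric] using fin finV dV by (intro sum.UNION_disjoint) auto
  have sum_arcs: "(\<Sum>e\<in>arcs H. f e) = (\<Sum>K\<in>?J. \<Sum>e\<in>arcs K. f e)" for f :: "'e \<Rightarrow> complex"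
    unfolding UA[symmetric] using fin finA dA by (intro sum.UNION_disjoint) auto
  \<comment> \<open>Needed to distribute the prefactor, a power of \<alpha>, over the
    components.\<close>
  have card: "card (verts H) = (\<Sum>K\<in>?J. card (verts K))"
    unfolding UV[symmetric] using fin finV dV by (intro card_UN_disjoint) auto
  have "zono_integrand H x y \<alpha> \<tau> = (\<Prod>K\<in>?J. zono_integrand K x y \<alpha> \<tau>)" for \<tau>
    unfolding zono_integrand_def exp_sum[OF fin, symmetric] sum_verts sum_arcs
    by (simp add: sum_negf sum_distrib_left[symmetric] sum.distrib[symmetric] sub(3,4) cong: sum.cong)
  then have "(LINT \<tau> | PiM (verts H) (\<lambda>_. lborel). zono_integrand H x y \<alpha> \<tau>) =
      (LINT \<tau> | PiM (\<Union>K\<in>?J. verts K) (\<lambda>_. lborel). (\<Prod>K\<in>?J. zono_integrand K x y \<alpha> \<tau>))"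
    unfolding UV by simp
  also have "\<dots> = (\<Prod>K\<in>?J. LINT \<tau> | PiM (verts K) (\<lambda>_. lborel). zono_integrand K x y \<alpha> \<tau>)"
  proof (rule conjunct2[OF product_integral_disjoint_family[OF fin finV disjoint_verts_conn_components]])
    fix K assume K: "K \<in> ?J"
    show "integrable (PiM (verts K) (\<lambda>_. lborel)) (zono_integrand K x y \<alpha>)"
      using sub[OF K] assms by (intro integrable_zono_integrand) auto
    show "zono_integrand K x y \<alpha> (restrict \<tau> (verts K)) = zono_integrand K x y \<alpha> \<tau>" for \<tau>
      using sub(5)[OF K] by (intro zono_integrand_restrict) (rule fin_digraph.axioms(1))
  qed
  finally have "zono_integral H x y \<alpha> = (\<Prod>K\<in>?J. zono_integral K x y \<alpha>)"
    by (simp add: zono_integral_eq assms(1) sub(5) prod.distrib power_sum card cong: prod.cong)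
  moreover have "square_integral H y \<alpha> = (\<Prod>K\<in>?J. square_integral K y \<alpha>)"
    unfolding square_integral_def UA[symmetric]
    using fin finA dA by (intro prod.UNION_disjoint) auto
  ultimately show ?thesis
    unfolding corr_integral_def by (simp add: prod.distrib)
qed

section \<open>Edge factors at the pole and the residue\<close>

text \<open>The continuity statement lives on the fixed graph G, so its limit point has zero
  energies instead of missing edges. A zero energy gives the factor 1 because the base 2 cosh is
  nonzero.\<close>

lemma zono_integral_delete_edges:
  assumes "finite (arcs G)" and "I \<subseteq> arcs G"
  shows "zono_integral (delete_edges G I) x y \<alpha> = zono_integral G x (\<lambda>e. if e \<in> I then 0 else y e) \<alpha>"
proof -
  have "(\<Prod>e\<in>arcs G - I. complex_of_real (2 * cosh (\<tau> (tail G e) - \<tau> (head G e))) powr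
        (- (of_real \<alpha> * y e))) =
      (\<Prod>e\<in>arcs G. complex_of_real (2 * cosh (\<tau> (tail G e) - \<tau> (head G e))) powr
        (- (of_real \<alpha> * (if e \<in> I then 0 else y e))))" for \<tau>
    using assms
    by (intro prod.mono_neutral_cong_left) (auto simp: powr_2cosh simp del: of_real_mult)
  then show ?thesis unfolding zono_integral_def delete_edges_def by simp
qed

lemma tendsto_mult_square_factor_at_0:
  assumes "0 < \<alpha>"
  shows "((\<lambda>s. s * (of_real \<alpha> / 2 * Beta (2 * of_real \<alpha> * s) (2 * of_real \<alpha> * s))) \<longlongrightarrow> (1 / 2 :: complex)) (at 0)"
proof -
  let ?a = "2 * complex_of_real \<alpha>"
  have "filterlim (\<lambda>s. ?a * s) (at 0) (at 0)"
    using assms by (auto simp: filterlim_at eventually_at_filter intro!: tendsto_eq_intros)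
  \<comment> \<open>With a = 2 \<alpha>, the prefactor satisfies s \<alpha>/2 = (1/4) a s, so the
    limit 2 of the Beta factor yields 1/2.\<close>
  then have "((\<lambda>s. 1 / 4 * (?a * s * Beta (?a * s) (?a * s))) \<longlongrightarrow> 1 / 4 * 2) (at 0)"
    by (intro tendsto_mult_left filterlim_compose[OF tendsto_mult_Beta_at_0])
  then show ?thesis by (simp add: mult_ac)
qed

theorem mainTheorem8:
  fixes G :: "('v, 'e) pre_digraph" and I :: "'e set"
    and x :: "'v \<Rightarrow> real" and y :: "'e \<Rightarrow> real" and \<alpha> :: real
  assumes "fin_digraph G" and "loopfree_digraph G" and "Digraph_Component.connected G"
    and "I \<subseteq> arcs G"
    and "\<And>v. v \<in> verts G \<Longrightarrow> x v > 0"
    and "\<And>e. e \<in> arcs G - I \<Longrightarrow> y e > 0"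
    and "\<alpha> > 0"
  shows "has_residue_at_zero
           (\<lambda>z. corr_integral G (\<lambda>v. complex_of_real (x v)) z \<alpha>) I
           (\<lambda>e. complex_of_real (y e))
           (1 / 2 ^ card I *
            (\<Prod>K\<in>conn_components (delete_edges G I).
               corr_integral K (\<lambda>v. complex_of_real (x v)) (\<lambda>e. complex_of_real (y e)) \<alpha>))"
proof -
  interpret fin_digraph G by fact
  let ?x = "\<lambda>v. complex_of_real (x v)" and ?y = "\<lambda>e. complex_of_real (y e)"
  let ?H = "delete_edges G I"
  let ?b = "\<lambda>s :: complex. of_real \<alpha> / 2 * Beta (2 * of_real \<alpha> * s) (2 * of_real \<alpha> * s)"
  define y0 where "y0 = (\<lambda>e. if e \<in> I then 0 else ?y e)"
  define S where "S = {z. (\<forall>e\<in>I. z e \<noteq> 0) \<and> (\<forall>e. e \<notin> I \<longrightarrow> z e = ?y e)}"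
  define F where "F = inf (nhds y0) (principal S)"
  have in_S: "\<forall>\<^sub>F z in F. z \<in> S"
    unfolding F_def eventually_inf_principal by simp
  have coord: "((\<lambda>z. z e) \<longlongrightarrow> y0 e) F" for e
  proof -
    have "continuous_on UNIV (\<lambda>z :: 'e \<Rightarrow> complex. z e)"
      by (rule continuous_on_product_then_coordinatewise) (rule continuous_on_id)
    then have "((\<lambda>z. z e) \<longlongrightarrow> y0 e) (nhds y0)"
      by (rule continuous_on_tendsto_compose) (auto intro: filterlim_ident)
    then show ?thesis unfolding F_def by (rule tendsto_mono[OF inf_le1])
  qed
  \<comment> \<open>The Beta limit is taken along the punctured filter \<open>at 0\<close>; it
    applies because points of S have nonzero coordinates in I.\<close>
  have "((\<lambda>z. z e * ?b (z e)) \<longlongrightarrow> 1 / 2) F" if "e \<in> I" for e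
  proof (rule filterlim_compose[OF tendsto_mult_square_factor_at_0[OF assms(7)]])
    have "\<forall>\<^sub>F z in F. z e \<noteq> 0"
      using in_S by eventually_elim (use that in \<open>auto simp: S_def\<close>)
    then show "filterlim (\<lambda>z. z e) (at 0) F"
      using coord[of e] that by (simp add: filterlim_at y0_def)
  qed
  \<comment> \<open>Only the limit point must have nonnegative real parts: \<open>y0\<close> is 0 on
    I and positive on the remaining edges.\<close>
  moreover have "((\<lambda>z. zono_integral G ?x z \<alpha>) \<longlongrightarrow> zono_integral G ?x y0 \<alpha>) F"
    using assms coord
    by (intro tendsto_zono_integral) (auto simp: y0_def intro: less_imp_le)
  ultimately have "((\<lambda>z. (\<Prod>e\<in>I. z e * ?b (z e)) * square_integral ?H ?y \<alpha> * zono_integral G ?x z \<alpha>)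
      \<longlongrightarrow> (\<Prod>e\<in>I. 1 / 2) * square_integral ?H ?y \<alpha> * zono_integral G ?x y0 \<alpha>) F"
    by (intro tendsto_mult tendsto_prod tendsto_const) auto
  moreover have "\<forall>\<^sub>F z in F. (\<Prod>e\<in>I. z e * ?b (z e)) * square_integral ?H ?y \<alpha> * zono_integral G ?x z \<alpha> =
      (\<Prod>e\<in>I. z e) * corr_integral G ?x z \<alpha>"
    using in_S
  proof eventually_elim
    case (elim z)
    have "(\<Prod>e\<in>arcs G. ?b (z e)) = (\<Prod>e\<in>arcs G - I. ?b (z e)) * (\<Prod>e\<in>I. ?b (z e))"
      by (rule prod.subset_diff[OF assms(4) finite_arcs])
    \<comment> \<open>Membership in S freezes the energies outside I at y, so these Beta factors do
      not vary with z.\<close>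
    also have "(\<Prod>e\<in>arcs G - I. ?b (z e)) = square_integral ?H ?y \<alpha>"
      using elim unfolding square_integral_def delete_edges_def S_def by (auto intro!: prod.cong)
    finally show ?case
      unfolding corr_integral_def square_integral_def[of G] prod.distrib by (simp only: mult_ac)
  qed
  ultimately have lim: "((\<lambda>z. (\<Prod>e\<in>I. z e) * corr_integral G ?x z \<alpha>)
      \<longlongrightarrow> (\<Prod>e\<in>I. 1 / 2) * square_integral ?H ?y \<alpha> * zono_integral G ?x y0 \<alpha>) F"
    by (rule Lim_transform_eventually)
  have "zono_integral G ?x y0 \<alpha> = zono_integral ?H ?x ?y \<alpha>"
    unfolding y0_def using assms(4) by (simp add: zono_integral_delete_edges)
  then have "(\<Prod>e\<in>I. 1 / 2) * square_integral ?H ?y \<alpha> * zono_integral G ?x y0 \<alpha> =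
      1 / 2 ^ card I * corr_integral ?H ?x ?y \<alpha>"
    by (simp add: corr_integral_def power_divide)
  also have "corr_integral ?H ?x ?y \<alpha> = (\<Prod>K\<in>conn_components ?H. corr_integral K ?x ?y \<alpha>)"
  proof (rule corr_integral_conn_components)
    show "fin_digraph ?H"
      by unfold_locales (auto simp: delete_edges_def)
  qed (use assms in \<open>auto simp: delete_edges_def intro: less_imp_le\<close>)
  finally have "(\<Prod>e\<in>I. 1 / 2) * square_integral ?H ?y \<alpha> * zono_integral G ?x y0 \<alpha> =
      1 / 2 ^ card I * (\<Prod>K\<in>conn_components ?H. corr_integral K ?x ?y \<alpha>)" .
  with lim show ?thesis
    unfolding has_residue_at_zero_def F_def S_def y0_def by simp
qed

end
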